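(* For any $\delta>0$, there exists a differentiable function $f:\mathbb{R}^2\to\mathbb{R}$ which is $2\pi$-Lipschitz on the ball of radius $2\delta$ around the origin, such that the origin is a $(\delta,0)$-stationary point of $f$, and yet $$\min_{\mathbf{x}:\|\mathbf{x}\|\leq\delta}\|\nabla f(\mathbf{x})\|\ \geq\ 1.$$
   Context: $\|\cdot\|$ is the Euclidean norm. For a function $f$ that is Lipschitz in a neighborhood of $\mathbf{x}$, the set of (Clarke) generalized gradients $\partial f(\mathbf{x})$ is the convex hull of all limits $\lim_{k\to\infty}\nabla f(\mathbf{x}_k)$ over sequences $(\mathbf{x}_k)$ of differentiability points of $f$ converging to $\mathbf{x}$ for which the limit exists (so $\partial f(\mathbf{x})=\{\nabla f(\mathbf{x})\}$ if $f$ is continuously differentiable near $\mathbf{x}$). For $\delta>0$ and $\epsilon\geq 0$, a point $\mathbf{x}$ is a $(\delta,\epsilon)$-stationary point of $f$ if $$\min\Big\{\|\mathbf{u}\|:\ \mathbf{u}\in\mathrm{conv}\Big\{\bigcup_{\mathbf{y}:\|\mathbf{y}-\mathbf{x}\|\leq\delta}\partial f(\mathbf{y})\Big\}\Big\}\ \leq\ \epsilon,$$ where $\mathrm{conv}$ denotes the convex hull. *)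

theory Defs
  imports "HOL-Analysis.Analysis"
begin

definition grad :: "('a::euclidean_space \<Rightarrow> real) \<Rightarrow> 'a \<Rightarrow> 'a" where
  "grad f x = (THE D. GDERIV f x :> D)"

text \<open>The value of \<open>grad f x\<close> is meaningful only where \<open>f\<close> is differentiable, and
  \<open>clarke_gradients f x\<close> is the Clarke generalized gradient only where \<open>f\<close> is Lipschitz in a
  neighbourhood of \<open>x\<close>.\<close>

definition clarke_gradients :: "('a::euclidean_space \<Rightarrow> real) \<Rightarrow> 'a \<Rightarrow> 'a set" where
  "clarke_gradients f x = convex hull
     {g. \<exists>X. (\<forall>k::nat. f differentiable (at (X k))) \<and> X \<longlonglongrightarrow> x \<and> (\<lambda>k. grad f (X k)) \<longlonglongrightarrow> g}"

text \<open>The minimum is required to be attained; it is whenever \<open>f\<close> is Lipschitz near every point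
  of the closed ball, since the convex hull is then nonempty and compact.\<close>

definition stationary_point ::
    "real \<Rightarrow> real \<Rightarrow> ('a::euclidean_space \<Rightarrow> real) \<Rightarrow> 'a \<Rightarrow> bool" where
  "stationary_point \<delta> \<epsilon> f x \<longleftrightarrow>
     (\<exists>u. is_arg_min norm (\<lambda>u. u \<in> convex hull (\<Union>y\<in>cball x \<delta>. clarke_gradients f y)) u
        \<and> norm u \<le> \<epsilon>)"

end

theory Submission imports Defs begin

text \<open>The witness is \<open>f(u,v) = (2\<delta> + u) sin (\<pi>v / 2\<delta>)\<close>, with gradient
  \<open>(sin (\<pi>v / 2\<delta>), (\<pi> / 2\<delta>) (2\<delta> + u) cos (\<pi>v / 2\<delta>))\<close>. The gradients at \<open>(0, \<delta>)\<close> and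
  \<open>(0, -\<delta>)\<close> are \<open>(1,0)\<close> and \<open>(-1,0)\<close>, which average to zero. The factor of the cosine has
  absolute value at least \<open>\<pi>/2 > 1\<close> on the ball of radius \<open>\<delta>\<close> and at most \<open>2\<pi>\<close> on the ball of
  radius \<open>2\<delta>\<close>; by \<open>sin\<^sup>2 + cos\<^sup>2 = 1\<close>, the norm of the gradient is then at least \<open>1\<close> on the first
  ball and at most \<open>2\<pi>\<close> on the second.\<close>

text \<open>Derivatives are unique and a vector is determined by its inner products, so the
  description operator has only \<open>D\<close> to pick.\<close>

lemma grad_eqI:
  assumes "GDERIV f x :> D"
  shows "grad f x = D"
  unfolding grad_def
proof (rule the_equality)
  fix D' assume "GDERIV f x :> D'"
  with assms have "(\<lambda>h. h \<bullet> D') = (\<lambda>h. h \<bullet> D)"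
    unfolding gderiv_def by (rule has_derivative_unique[rotated])
  then show "D' = D"
    unfolding fun_eq_iff vector_eq_ldot .
qed (fact assms)

text \<open>The constant sequence at \<open>x\<close> is admissible, so continuity of the gradient
  is never invoked.\<close>

lemma grad_in_clarke_gradients:
  assumes "f differentiable (at x)"
  shows "grad f x \<in> clarke_gradients f x"
  unfolding clarke_gradients_def
  using assms by (intro hull_inc CollectI exI[of _ "\<lambda>_. x"]) auto

text \<open>Mean value inequality on a convex set: by Cauchy-Schwarz, the operator norm of the
  derivative is at most the norm of the gradient.\<close>

lemma lipschitz_on_GDERIV_bound:
  assumes "convex S" "0 \<le> L"
    and "\<And>x. x \<in> S \<Longrightarrow> GDERIV f x :> G x"
    and "\<And>x. x \<in> S \<Longrightarrow> norm (G x) \<le> L"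
  shows "L-lipschitz_on S f"
proof (rule lipschitz_onI)
  fix x y assume "x \<in> S" "y \<in> S"
  have "norm (f x - f y) \<le> L * norm (x - y)"
  proof (rule differentiable_bound[OF \<open>convex S\<close> _ _ \<open>x \<in> S\<close> \<open>y \<in> S\<close>])
    show "(f has_derivative (\<lambda>h. h \<bullet> G z)) (at z within S)" if "z \<in> S" for z
      using assms(3)[OF that] unfolding gderiv_def by (rule has_derivative_at_withinI)
    show "onorm (\<lambda>h. h \<bullet> G z) \<le> L" if "z \<in> S" for z
    proof (rule onorm_bound)
      fix h
      have "norm (h \<bullet> G z) \<le> norm h * norm (G z)"
        by (simp add: Cauchy_Schwarz_ineq2)
      also have "\<dots> \<le> norm h * L"
        by (intro mult_left_mono assms(4) that) simp
      finally show "norm (h \<bullet> G z) \<le> L * norm h"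
        by (simp add: mult.commute)
    qed fact
  qed
  then show "dist (f x) (f y) \<le> L * dist x y"
    by (simp add: dist_norm)
qed fact

lemma norm_vector_2:
  fixes a b :: real
  shows "norm (vector [a, b] :: real ^ 2) = sqrt (a\<^sup>2 + b\<^sup>2)"
  by (simp add: norm_vec_def L2_set_def sum_2)

theorem proposition1:
  fixes \<delta> :: real
  assumes "\<delta> > 0"
  shows "\<exists>f :: real ^ 2 \<Rightarrow> real.
    f differentiable_on UNIV \<and>
    (2 * pi)-lipschitz_on (cball 0 (2 * \<delta>)) f \<and>
    stationary_point \<delta> 0 f 0 \<and>
    (\<exists>x. is_arg_min (\<lambda>x. norm (grad f x)) (\<lambda>x. norm x \<le> \<delta>) x \<and> norm (grad f x) \<ge> 1)"
proof -
  \<comment> \<open>A quarter period of the sine has length \<delta>, so the cosine vanishes where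
    the second coordinate is \<delta> or -\<delta>.\<close>
  define c where "c = pi / (2 * \<delta>)"
  define f where "f = (\<lambda>x :: real ^ 2. (2 * \<delta> + x $ 1) * sin (c * x $ 2))"
  define G where "G = (\<lambda>x :: real ^ 2.
    vector [sin (c * x $ 2), c * (2 * \<delta> + x $ 1) * cos (c * x $ 2)] :: real ^ 2)"
  define p where "p = (vector [0, \<delta>] :: real ^ 2)"
  have c: "c > 0" "c * \<delta> = pi / 2"
    using assms by (auto simp: c_def)
  have G: "GDERIV f x :> G x" for x
    unfolding gderiv_def f_def G_def
    by (auto intro!: derivative_eq_intros bounded_linear.has_derivative[OF bounded_linear_vec_nth]
        simp: inner_vec_def sum_2 algebra_simps)
  have diff: "f differentiable (at x)" for x
    using G[of x] unfolding gderiv_def differentiable_def by blast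
  have grad: "grad f x = G x" for x
    using G by (rule grad_eqI)
  have norm_G: "norm (G x) =
      sqrt ((sin (c * x $ 2))\<^sup>2 + (c * (2 * \<delta> + x $ 1))\<^sup>2 * (cos (c * x $ 2))\<^sup>2)" for x
    by (simp add: G_def norm_vector_2 power_mult_distrib)

  have "norm (G x) \<le> 2 * pi" if "x \<in> cball 0 (2 * \<delta>)" for x
  proof -
    have "\<bar>x $ 1\<bar> \<le> 2 * \<delta>"
      using that component_le_norm_cart[of x 1] by simp
    then have "\<bar>c * (2 * \<delta> + x $ 1)\<bar> \<le> c * (4 * \<delta>)"
      unfolding abs_mult using c by (intro mult_mono) auto
    also have "\<dots> = 2 * pi"
      using c by (simp add: mult.commute mult.left_commute)
    finally have "(c * (2 * \<delta> + x $ 1))\<^sup>2 \<le> (2 * pi)\<^sup>2"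
      using power2_le_iff_abs_le[of "2 * pi"] by simp
    \<comment> \<open>This raises the coefficient 1 of the squared sine to that of the squared
      cosine, so that the two squares can be summed.\<close>
    moreover have "1 \<le> (2 * pi)\<^sup>2"
      using pi_ge_two by (intro one_le_power) simp
    ultimately have "(sin (c * x $ 2))\<^sup>2 + (c * (2 * \<delta> + x $ 1))\<^sup>2 * (cos (c * x $ 2))\<^sup>2
        \<le> (2 * pi)\<^sup>2 * (sin (c * x $ 2))\<^sup>2 + (2 * pi)\<^sup>2 * (cos (c * x $ 2))\<^sup>2"
      using mult_right_mono[of 1 "(2 * pi)\<^sup>2" "(sin (c * x $ 2))\<^sup>2"]
      by (intro add_mono mult_right_mono) auto
    also have "\<dots> = (2 * pi)\<^sup>2"
      by (simp flip: distrib_left)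
    finally show ?thesis
      unfolding norm_G by (intro real_le_lsqrt) auto
  qed
  then have lip: "(2 * pi)-lipschitz_on (cball 0 (2 * \<delta>)) f"
    by (intro lipschitz_on_GDERIV_bound[where G = G] G) auto

  have lower: "1 \<le> norm (G x)" if "norm x \<le> \<delta>" for x
  proof -
    have "\<bar>x $ 1\<bar> \<le> \<delta>"
      using that component_le_norm_cart[of x 1] by simp
    \<comment> \<open>The left side is \<open>pi / 2\<close>, which is at least 1.\<close>
    then have "c * \<delta> \<le> c * (2 * \<delta> + x $ 1)"
      using c by (intro mult_left_mono) auto
    then have "1 \<le> (c * (2 * \<delta> + x $ 1))\<^sup>2"
      using c pi_ge_two by (intro one_le_power) simp
    then have "(sin (c * x $ 2))\<^sup>2 + 1 * (cos (c * x $ 2))\<^sup>2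
        \<le> (sin (c * x $ 2))\<^sup>2 + (c * (2 * \<delta> + x $ 1))\<^sup>2 * (cos (c * x $ 2))\<^sup>2"
      by (intro add_left_mono mult_right_mono) auto
    then show ?thesis
      by (simp add: norm_G)
  qed

  have norm_p: "norm p = \<delta>"
    using assms by (simp add: p_def norm_vector_2)
  have Gp: "G p = vector [1, 0]" and Gm: "G (- p) = - vector [1, 0]"
    by (simp_all add: G_def p_def c(2) vec_eq_iff forall_2)

  let ?U = "\<Union>y\<in>cball 0 \<delta>. clarke_gradients f y"
  have in_U: "G y \<in> convex hull ?U" if "norm y \<le> \<delta>" for y
    using grad_in_clarke_gradients[OF diff[of y]] that
    by (intro hull_inc) (auto simp: grad)
  have "(1 / 2) *\<^sub>R G p + (1 / 2) *\<^sub>R G (- p) \<in> convex hull ?U"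
    by (intro convexD convex_convex_hull in_U) (auto simp: norm_p)
  then have "0 \<in> convex hull ?U"
    by (simp add: Gp Gm)
  then have "stationary_point \<delta> 0 f 0"
    unfolding stationary_point_def is_arg_min_linorder by (intro exI[of _ 0]) auto
  \<comment> \<open>The minimum is attained at \<open>p\<close>, on the boundary of the ball: the
    gradient there has norm exactly 1, matching the bound \<open>lower\<close>.\<close>
  moreover have "is_arg_min (\<lambda>x. norm (grad f x)) (\<lambda>x. norm x \<le> \<delta>) p"
    using lower norm_p by (auto simp: is_arg_min_linorder grad Gp norm_vector_2)
  moreover have "norm (grad f p) \<ge> 1"
    using lower norm_p by (simp add: grad)
  ultimately show ?thesis
    using diff lip by (auto simp: differentiable_on_eq_differentiable_at)
qed

end
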